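(* Let $\mathfrak g=\mathfrak{sl}_n$, let $A\subset\Pi$ be an arbitrary subset of the set of simple roots, and let $I=I(A)$ be the $\mathsf{ad}$-nilpotent ideal whose set of generators is $A$. Then $I^*=I(\Pi\setminus A)$.
   Context: Positive roots of $\mathfrak{sl}_n$ ($n\ge2$) are identified with pairs $(i,j)$, $1\le i<j\le n$, where $\Pi=\{\alpha_1,\dots,\alpha_{n-1}\}$, $\alpha_i=(i,i+1)$, and $(i,j)=\alpha_i+\dots+\alpha_{j-1}$. An $\mathsf{ad}$-nilpotent ideal is a set $I$ of positive roots such that $(i,j)\in I$, $i'\le i$, $j'\ge j$ imply $(i',j')\in I$; its generators are its minimal elements in the root order (so antichains of positive roots correspond bijectively to ideals). For an antichain $\Gamma$, $I(\Gamma)$ denotes the ideal whose set of generators is $\Gamma$. Duality $I\mapsto I^*$: if the generators of $I$ are $(i_1,j_1),\dots,(i_k,j_k)$, then $I^*$ is the ideal with generators $(i_q^*,j_q^* )$, $1\le q\le n-1-k$, where $i_1^*<i_2^*<\cdots$ are the elements of $\{1,\dots,n-1\}\setminus\{j_1-1,\dots,j_k-1\}$ and $j_1^*<j_2^*<\cdots$ are the elements of $\{2,\dots,n\}\setminus\{i_1+1,\dots,i_k+1\}$. This is a well-defined involution on the set of $\mathsf{ad}$-nilpotent ideals of $\mathfrak{sl}_n$. *)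

theory Defs
  imports Main
begin

(* The pair (i, j) stands for the positive root alpha_i + ... + alpha_(j-1) of sl_n. *)
type_synonym root = "nat \<times> nat"

definition positive_roots :: "nat \<Rightarrow> root set" where
  "positive_roots n = {(i, j). 1 \<le> i \<and> i < j \<and> j \<le> n}"

definition simple_roots :: "nat \<Rightarrow> root set" where
  "simple_roots n = (\<lambda>i. (i, i + 1)) ` {1..n - 1}"

definition simple_coeff :: "root \<Rightarrow> nat \<Rightarrow> nat" where
  "simple_coeff \<beta> k = (if fst \<beta> \<le> k \<and> k < snd \<beta> then 1 else 0)"

(* The root order: the difference is a nonnegative combination of simple roots. *)
definition root_le :: "root \<Rightarrow> root \<Rightarrow> bool" where
  "root_le \<beta> \<gamma> \<longleftrightarrow> (\<forall>k. simple_coeff \<beta> k \<le> simple_coeff \<gamma> k)"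

lemma root_le_iff:
  assumes "i < j"
  shows "root_le (i, j) (i', j') \<longleftrightarrow> i' \<le> i \<and> j \<le> j'"
proof
  assume L: "root_le (i, j) (i', j')"
  have "simple_coeff (i, j) i \<le> simple_coeff (i', j') i"
    "simple_coeff (i, j) (j - 1) \<le> simple_coeff (i', j') (j - 1)"
    using L unfolding root_le_def by blast+
  then show "i' \<le> i \<and> j \<le> j'"
    using assms by (auto simp: simple_coeff_def split: if_splits)
next
  assume "i' \<le> i \<and> j \<le> j'"
  then show "root_le (i, j) (i', j')"
    by (auto simp: root_le_def simple_coeff_def)
qed

definition ad_nilpotent_ideal :: "nat \<Rightarrow> root set \<Rightarrow> bool" where
  "ad_nilpotent_ideal n I \<longleftrightarrow> I \<subseteq> positive_roots n \<and>
     (\<forall>i j i' j'. (i, j) \<in> I \<and> (i', j') \<in> positive_roots n \<and> i' \<le> i \<and> j \<le> j' \<longrightarrow> (i', j') \<in> I)"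

definition generators :: "root set \<Rightarrow> root set" where
  "generators I = {\<beta> \<in> I. \<forall>\<gamma>\<in>I. root_le \<gamma> \<beta> \<longrightarrow> \<gamma> = \<beta>}"

definition root_antichain :: "nat \<Rightarrow> root set \<Rightarrow> bool" where
  "root_antichain n \<Gamma> \<longleftrightarrow> \<Gamma> \<subseteq> positive_roots n \<and> (\<forall>\<beta>\<in>\<Gamma>. \<forall>\<gamma>\<in>\<Gamma>. root_le \<beta> \<gamma> \<longrightarrow> \<beta> = \<gamma>)"

(* Meaningful for antichains only, see ex1_ideal_with_generators. *)
definition ideal_of :: "nat \<Rightarrow> root set \<Rightarrow> root set" where
  "ideal_of n \<Gamma> = (THE I. ad_nilpotent_ideal n I \<and> generators I = \<Gamma>)"

lemma ideal_above_generator: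
  assumes "ad_nilpotent_ideal n I" "(i, j) \<in> I"
  shows "\<exists>a b. (a, b) \<in> generators I \<and> i \<le> a \<and> b \<le> j"
  using assms(2)
proof (induction "j - i" arbitrary: i j rule: less_induct)
  case less
  have pos: "\<And>a b. (a, b) \<in> I \<Longrightarrow> a < b"
    using assms(1) by (auto simp: ad_nilpotent_ideal_def positive_roots_def)
  show ?case
  proof (cases "(i, j) \<in> generators I")
    case True
    then show ?thesis by blast
  next
    case False
    then obtain a b where ab: "(a, b) \<in> I" "root_le (a, b) (i, j)" "(a, b) \<noteq> (i, j)"
      using less.prems by (auto simp: generators_def)
    then have le: "i \<le> a" "b \<le> j" using root_le_iff pos by blast+
    then have "b - a < j - i" using pos[OF ab(1)] ab(3) by auto
    from less.hyps[OF this ab(1)] show ?thesis using le by (meson le_trans)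
  qed
qed

lemma ex1_ideal_with_generators:
  assumes "root_antichain n \<Gamma>"
  shows "\<exists>!I. ad_nilpotent_ideal n I \<and> generators I = \<Gamma>"
proof -
  define U where "U = {(i, j). (i, j) \<in> positive_roots n \<and> (\<exists>a b. (a, b) \<in> \<Gamma> \<and> i \<le> a \<and> b \<le> j)}"
  have pos: "\<And>a b. (a, b) \<in> \<Gamma> \<Longrightarrow> (a, b) \<in> positive_roots n \<and> a < b"
    using assms by (auto simp: root_antichain_def positive_roots_def)
  have anti: "\<And>a b c d. (a, b) \<in> \<Gamma> \<Longrightarrow> (c, d) \<in> \<Gamma> \<Longrightarrow> c \<le> a \<Longrightarrow> b \<le> d \<Longrightarrow> a = c \<and> b = d"
    using assms pos root_le_iff unfolding root_antichain_def by (metis prod.inject)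
  have Upos: "\<And>a b. (a, b) \<in> U \<Longrightarrow> a < b"
    by (auto simp: U_def positive_roots_def)
  have GU: "\<Gamma> \<subseteq> U" using pos by (auto simp: U_def)
  have idl: "ad_nilpotent_ideal n U"
    unfolding ad_nilpotent_ideal_def U_def by (fastforce intro: le_trans)
  have gen: "generators U = \<Gamma>"
  proof
    show "generators U \<subseteq> \<Gamma>"
    proof
      fix x assume x: "x \<in> generators U"
      obtain i j where [simp]: "x = (i, j)" by (cases x)
      from x obtain a b where "(a, b) \<in> \<Gamma>" "i \<le> a" "b \<le> j"
        by (auto simp: generators_def U_def)
      moreover from this have "root_le (a, b) (i, j)" using root_le_iff pos by blast
      ultimately show "x \<in> \<Gamma>" using x GU by (auto simp: generators_def)
    qed
    show "\<Gamma> \<subseteq> generators U"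
    proof
      fix x assume x: "x \<in> \<Gamma>"
      obtain i j where [simp]: "x = (i, j)" by (cases x)
      have "(c, d) = x" if cd: "(c, d) \<in> U" "root_le (c, d) (i, j)" for c d
      proof -
        have 1: "i \<le> c" "d \<le> j" using cd Upos root_le_iff by blast+
        from cd(1) obtain a b where 2: "(a, b) \<in> \<Gamma>" "c \<le> a" "b \<le> d"
          by (auto simp: U_def)
        have "a = i \<and> b = j" using anti[OF 2(1), of i j] x 1 2 by simp
        then show ?thesis using 1 2 by simp
      qed
      then show "x \<in> generators U" using x GU by (auto simp: generators_def)
    qed
  qed
  have "I = U" if I: "ad_nilpotent_ideal n I" "generators I = \<Gamma>" for I
  proof
    show "I \<subseteq> U"
    proof
      fix x assume "x \<in> I"
      then show "x \<in> U" using ideal_above_generator[OF I(1), of "fst x" "snd x"] I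
        by (cases x) (auto simp: U_def ad_nilpotent_ideal_def)
    qed
    have sub: "\<Gamma> \<subseteq> I" using I(2) by (auto simp: generators_def)
    show "U \<subseteq> I"
      using sub I(1) unfolding U_def ad_nilpotent_ideal_def by blast
  qed
  with idl gen show ?thesis by blast
qed

corollary ideal_of_antichain:
  assumes "root_antichain n \<Gamma>"
  shows "ad_nilpotent_ideal n (ideal_of n \<Gamma>)" "generators (ideal_of n \<Gamma>) = \<Gamma>"
  using theI'[OF ex1_ideal_with_generators[OF assms]] by (simp_all add: ideal_of_def)

(* The increasing enumerations i*_1 < i*_2 < ... and j*_1 < j*_2 < ...; list positions start at 0. *)
definition dual_left :: "nat \<Rightarrow> root set \<Rightarrow> nat list" where
  "dual_left n I = sorted_list_of_set ({1..n - 1} - (\<lambda>(i, j). j - 1) ` generators I)"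

definition dual_right :: "nat \<Rightarrow> root set \<Rightarrow> nat list" where
  "dual_right n I = sorted_list_of_set ({2..n} - (\<lambda>(i, j). i + 1) ` generators I)"

definition dual_generators :: "nat \<Rightarrow> root set \<Rightarrow> root set" where
  "dual_generators n I =
     {(dual_left n I ! q, dual_right n I ! q) | q. q < n - 1 - card (generators I)}"

definition dual_ideal :: "nat \<Rightarrow> root set \<Rightarrow> root set" where
  "dual_ideal n I = ideal_of n (dual_generators n I)"

end

theory Submission
  imports Defs
begin

text \<open>Write \<open>A\<close> as the roots \<open>(i, i + 1)\<close> with \<open>i\<close> in
  \<open>S\<close>. A simple root has \<open>j - 1 = i\<close>, so the dual removes \<open>S\<close>
  from the left ends and \<open>Suc\<close>
  S\<open>from the right ends, leaving\<close>C\<open>and\<close>Suc \<open>C\<close>. The successor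
  map is increasing (\<open>sorted_list_of_set_image_Suc\<close>), so equal positions of the two
  enumerations hold \<open>c\<close> and \<open>c + 1\<close>: the dual generators are the simple
  roots indexed by \<open>C\<close>, the complement of \<open>A\<close>.\<close>

lemma sorted_list_of_set_image_Suc:
  assumes "finite A"
  shows "sorted_list_of_set (Suc ` A) = map Suc (sorted_list_of_set A)"
proof (rule sorted_distinct_set_unique)
  show "sorted (map Suc (sorted_list_of_set A))"
    by (auto simp: sorted_map intro: sorted_wrt_mono_rel[OF _ sorted_sorted_list_of_set])
qed (use assms in \<open>auto simp: distinct_map\<close>)

text \<open>If \<open>(i, i + 1)\<close> lies below \<open>(k, k + 1)\<close>, then
  \<open>k \<le> i\<close> and \<open>i + 1 \<le> k + 1\<close>, so \<open>i = k\<close>. This makes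
  \<open>ideal_of n A\<close> meaningful, with generator set exactly \<open>A\<close>.\<close>

lemma root_antichain_simple:
  assumes "A \<subseteq> simple_roots n"
  shows "root_antichain n A"
proof -
  have simple: "\<exists>i. \<beta> = (i, i + 1) \<and> 1 \<le> i \<and> i + 1 \<le> n" if "\<beta> \<in> A" for \<beta>
    using subsetD[OF assms that] by (auto simp: simple_roots_def)
  have "A \<subseteq> positive_roots n"
    using simple by (fastforce simp: positive_roots_def)
  moreover have "\<beta> = \<gamma>" if "\<beta> \<in> A" "\<gamma> \<in> A" "root_le \<beta> \<gamma>" for \<beta> \<gamma>
    using simple[OF that(1)] simple[OF that(2)] that(3) by (auto simp: root_le_iff)
  ultimately show ?thesis
    by (auto simp: root_antichain_def)
qed

theorem lemma4p4:
  fixes n :: nat and A :: "root set"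
  assumes "n \<ge> 2" and "A \<subseteq> simple_roots n"
  shows "dual_ideal n (ideal_of n A) = ideal_of n (simple_roots n - A)"
proof -
  let ?r = "\<lambda>i::nat. (i, i + 1)"
  have inj: "inj ?r" by (auto simp: inj_def)
  obtain S where S: "S \<subseteq> {1..n - 1}" and A: "A = ?r ` S"
    using assms(2) unfolding simple_roots_def by (auto simp: subset_image_iff)
  define C where "C = {1..n - 1} - S"
  define xs where "xs = sorted_list_of_set C"
  have finC: "finite C" and finS: "finite S"
    using S finite_subset by (auto simp: C_def)
  have gen: "generators (ideal_of n A) = A"
    by (rule ideal_of_antichain[OF root_antichain_simple[OF assms(2)]])
  have left: "dual_left n (ideal_of n A) = xs"
    unfolding dual_left_def gen by (simp add: A image_image C_def xs_def)
  have "{2..n} = Suc ` {1..n - 1}"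
    using assms(1) by (simp add: numeral_2_eq_2)
  then have "{2..n} - Suc ` S = Suc ` C"
    by (simp only: C_def image_set_diff[OF inj_Suc])
  then have right: "dual_right n (ideal_of n A) = map Suc xs"
    unfolding dual_right_def gen
    by (simp add: A image_image sorted_list_of_set_image_Suc[OF finC] xs_def)
  \<comment> \<open>The index bound is \<open>card C\<close>, so \<open>q\<close> runs through all
    of \<open>xs\<close> and never past its end; only there does \<open>map Suc xs ! q\<close> equal
    \<open>Suc (xs ! q)\<close>.\<close>
  have len: "n - 1 - card (generators (ideal_of n A)) = length xs"
    unfolding gen xs_def using S finS
    by (simp add: A C_def card_Diff_subset card_image inj_on_def)
  have "dual_generators n (ideal_of n A) = {?r (xs ! q) | q. q < length xs}"
    unfolding dual_generators_def len left right by force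
  also have "\<dots> = ?r ` set xs"
    by (auto simp: set_conv_nth)
  \<comment> \<open>Injectivity of \<open>i \<mapsto> (i, i + 1)\<close> turns the complement of
    \<open>S\<close> into the complement of \<open>A\<close>.\<close>
  also have "\<dots> = simple_roots n - A"
    by (simp only: xs_def set_sorted_list_of_set[OF finC])
       (simp only: C_def simple_roots_def A image_set_diff[OF inj])
  finally show ?thesis
    by (simp add: dual_ideal_def)
qed

end
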